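(* Let $R$ be a ring filtered by a set $\{U_i:i\in\mathbb N\}$ of additive subgroups. Suppose further that, for all $i\in\mathbb N$, $U_i$ is a free left (respectively, right) $U_0$-module of rank $i+1$. Then the following two statements hold. (i) If $U_0$ satisfies LSRC (respectively, RSRC), then $R$ satisfies LSRC (respectively, RSRC). (ii) If $R$ satisfies RSRC (respectively, LSRC), then $U_0$ satisfies RSRC (respectively, LSRC).
   Context: Rings are associative and unital (not necessarily commutative). $\mathbb N=\{0,1,2,\dots\}$. A set $\{U_i:i\in\mathbb N\}$ of additive subgroups of a ring $R$ is a filtration of $R$ (and $R$ is said to be filtered by it) if: (i) $U_0\subseteq U_1\subseteq U_2\subseteq\cdots$; (ii) $U_iU_j\subseteq U_{i+j}$ for all $i,j\in\mathbb N$; (iii) $\bigcup_{i=0}^\infty U_i=R$; (iv) $1\in U_0$. In this case $U_0$ is a unital subring of $R$ and each $U_i$ is both a left and a right $U_0$-submodule of $R$. "Free of rank $k$" means having a basis with exactly $k$ elements, i.e. being isomorphic to $U_0^k$. A ring $R$ satisfies the right strong rank condition (RSRC) if, for every positive integer $n$, there is no right $R$-module monomorphism $R^{n+1}\to R^n$; it satisfies the left strong rank condition (LSRC) if, for every positive integer $n$, there is no left $R$-module monomorphism $R^{n+1}\to R^n$. "Respectively" is read consistently throughout: the first alternatives go with the $U_i$ being free left modules, the second alternatives with the $U_i$ being free right modules. *)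

theory Defs
  imports "HOL-Algebra.Algebra"
begin

section \<open>Filtered rings\<close>

locale ring_filtration = ring R for R (structure) +
  fixes U :: "nat \<Rightarrow> 'a set"
  assumes filt_additive_subgroup: "additive_subgroup (U i) R"
    and filt_mono: "U i \<subseteq> U (Suc i)"
    and filt_mult: "U i <#> U j \<subseteq> U (i + j)"
    and filt_exhaustive: "(\<Union>i. U i) = carrier R"
    and filt_one: "\<one> \<in> U 0"
begin

lemma filt_subset: "U i \<subseteq> carrier R"
  using filt_exhaustive by blast

lemma filt_multI: "a \<in> U i \<Longrightarrow> b \<in> U j \<Longrightarrow> a \<otimes> b \<in> U (i + j)"
  using filt_mult[of i j] by (auto simp: set_mult_def)

lemma filt_subring_zero: "subring (U 0) R"
proof (rule subringI)
  have sg: "subgroup (U 0) (add_monoid R)"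
    using filt_additive_subgroup by (rule additive_subgroup.a_subgroup)
  show "U 0 \<subseteq> carrier R" by (rule filt_subset)
  show "\<one> \<in> U 0" by (rule filt_one)
  show "\<ominus> h \<in> U 0" if "h \<in> U 0" for h
    using subgroup.m_inv_closed[OF sg that] by (simp add: a_inv_def)
  show "a \<otimes> b \<in> U 0" if "a \<in> U 0" "b \<in> U 0" for a b
    using filt_multI[OF that] by simp
  show "a \<oplus> b \<in> U 0" if "a \<in> U 0" "b \<in> U 0" for a b
    using subgroup.m_closed[OF sg that] by simp
qed

lemma filt_ring_zero: "ring (R\<lparr>carrier := U 0\<rparr>)"
  using filt_subring_zero by (rule subring_is_ring)

end

section \<open>Left and right modules over a not necessarily commutative ring\<close>

text \<open>
  The locale \<open>module\<close> of the library requires a commutative ring, so only the record type is used.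
  A right module is stored with its scalar as the first argument of \<open>smult\<close>: there
  \<open>a \<odot> x\<close> stands for $x a$. The ring fields \<open>mult\<close> and \<open>one\<close> of the record play no
  role for a module.
\<close>

definition module_hom ::
    "('r, 'm) ring_scheme \<Rightarrow> ('r, 'a) module \<Rightarrow> ('r, 'b) module \<Rightarrow> ('a \<Rightarrow> 'b) set" where
  "module_hom S M N =
    {h \<in> hom (add_monoid M) (add_monoid N).
      \<forall>a \<in> carrier S. \<forall>x \<in> carrier M. h (a \<odot>\<^bsub>M\<^esub> x) = a \<odot>\<^bsub>N\<^esub> h x}"

definition module_mon ::
    "('r, 'm) ring_scheme \<Rightarrow> ('r, 'a) module \<Rightarrow> ('r, 'b) module \<Rightarrow> ('a \<Rightarrow> 'b) set" where
  "module_mon S M N = {h \<in> module_hom S M N. inj_on h (carrier M)}"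

definition module_iso ::
    "('r, 'm) ring_scheme \<Rightarrow> ('r, 'a) module \<Rightarrow> ('r, 'b) module \<Rightarrow> ('a \<Rightarrow> 'b) set" where
  "module_iso S M N = {h \<in> module_hom S M N. bij_betw h (carrier M) (carrier N)}"

text \<open>An additive subgroup \<open>V\<close> of \<open>R\<close> with scalars acting by multiplication in \<open>R\<close>.\<close>

definition left_mod :: "('a, 'm) ring_scheme \<Rightarrow> 'a set \<Rightarrow> ('a, 'a) module" where
  "left_mod R V =
    \<lparr>carrier = V, monoid.mult = undefined, one = undefined,
     ring.zero = \<zero>\<^bsub>R\<^esub>, ring.add = (\<lambda>x y. x \<oplus>\<^bsub>R\<^esub> y), smult = (\<lambda>a x. a \<otimes>\<^bsub>R\<^esub> x)\<rparr>"

definition right_mod :: "('a, 'm) ring_scheme \<Rightarrow> 'a set \<Rightarrow> ('a, 'a) module" where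
  "right_mod R V =
    \<lparr>carrier = V, monoid.mult = undefined, one = undefined,
     ring.zero = \<zero>\<^bsub>R\<^esub>, ring.add = (\<lambda>x y. x \<oplus>\<^bsub>R\<^esub> y), smult = (\<lambda>a x. x \<otimes>\<^bsub>R\<^esub> a)\<rparr>"

text \<open>The standard free modules $S^n$, with coordinates indexed by \<open>{..<n}\<close>.\<close>

definition left_power :: "('a, 'm) ring_scheme \<Rightarrow> nat \<Rightarrow> ('a, nat \<Rightarrow> 'a) module" where
  "left_power S n =
    \<lparr>carrier = {..<n} \<rightarrow>\<^sub>E carrier S, monoid.mult = undefined, one = undefined,
     ring.zero = (\<lambda>i\<in>{..<n}. \<zero>\<^bsub>S\<^esub>),
     ring.add = (\<lambda>x y. \<lambda>i\<in>{..<n}. x i \<oplus>\<^bsub>S\<^esub> y i),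
     smult = (\<lambda>a x. \<lambda>i\<in>{..<n}. a \<otimes>\<^bsub>S\<^esub> x i)\<rparr>"

definition right_power :: "('a, 'm) ring_scheme \<Rightarrow> nat \<Rightarrow> ('a, nat \<Rightarrow> 'a) module" where
  "right_power S n =
    \<lparr>carrier = {..<n} \<rightarrow>\<^sub>E carrier S, monoid.mult = undefined, one = undefined,
     ring.zero = (\<lambda>i\<in>{..<n}. \<zero>\<^bsub>S\<^esub>),
     ring.add = (\<lambda>x y. \<lambda>i\<in>{..<n}. x i \<oplus>\<^bsub>S\<^esub> y i),
     smult = (\<lambda>a x. \<lambda>i\<in>{..<n}. x i \<otimes>\<^bsub>S\<^esub> a)\<rparr>"

text \<open>
  Free of rank \<open>k\<close> means isomorphic to $S^k$; over the zero ring, which is allowed here, the zero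
  module is therefore free of every rank.
\<close>

definition left_free_of_rank :: "('a, 'm) ring_scheme \<Rightarrow> ('a, 'b) module \<Rightarrow> nat \<Rightarrow> bool" where
  "left_free_of_rank S M k \<longleftrightarrow> module_iso S (left_power S k) M \<noteq> {}"

definition right_free_of_rank :: "('a, 'm) ring_scheme \<Rightarrow> ('a, 'b) module \<Rightarrow> nat \<Rightarrow> bool" where
  "right_free_of_rank S M k \<longleftrightarrow> module_iso S (right_power S k) M \<noteq> {}"

section \<open>Strong rank conditions\<close>

definition LSRC :: "('a, 'm) ring_scheme \<Rightarrow> bool" where
  "LSRC S \<longleftrightarrow> (\<forall>n>0. module_mon S (left_power S (n + 1)) (left_power S n) = {})"

definition RSRC :: "('a, 'm) ring_scheme \<Rightarrow> bool" where
  "RSRC S \<longleftrightarrow> (\<forall>n>0. module_mon S (right_power S (n + 1)) (right_power S n) = {})"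

end

theory Submission
  imports Defs
begin

text \<open>
  For (i), write an injection $R^{n+1} \to R^n$ as a matrix with entries in some $U_d$. It restricts
  to injections $U_i^{n+1} \to U_{i+d}^n$ of free $U_0$-modules of ranks $(n+1)(i+1)$ and
  $n(i+d+1)$, and the first rank exceeds the second once $i \ge nd$. For (ii), a matrix over $U_0$
  that is injective on columns over $U_0$ stays injective on columns over $R$: the columns lie in
  some $U_i$, and the equations can be read off coordinatewise in a basis of $U_i$. The
  left/right mirror images come from the opposite ring.
\<close>

section \<open>Homomorphisms of modules\<close>

lemma module_homI:
  assumes "\<And>x. x \<in> carrier M \<Longrightarrow> h x \<in> carrier N"
    and "\<And>x y. x \<in> carrier M \<Longrightarrow> y \<in> carrier M \<Longrightarrow> h (x \<oplus>\<^bsub>M\<^esub> y) = h x \<oplus>\<^bsub>N\<^esub> h y"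
    and "\<And>a x. a \<in> carrier S \<Longrightarrow> x \<in> carrier M \<Longrightarrow> h (a \<odot>\<^bsub>M\<^esub> x) = a \<odot>\<^bsub>N\<^esub> h x"
  shows "h \<in> module_hom S M N"
  using assms by (auto simp: module_hom_def hom_def)

lemma module_homD:
  assumes "h \<in> module_hom S M N"
  shows "x \<in> carrier M \<Longrightarrow> h x \<in> carrier N"
    and "x \<in> carrier M \<Longrightarrow> y \<in> carrier M \<Longrightarrow> h (x \<oplus>\<^bsub>M\<^esub> y) = h x \<oplus>\<^bsub>N\<^esub> h y"
    and "a \<in> carrier S \<Longrightarrow> x \<in> carrier M \<Longrightarrow> h (a \<odot>\<^bsub>M\<^esub> x) = a \<odot>\<^bsub>N\<^esub> h x"
  using assms by (auto simp: module_hom_def hom_def)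

lemma module_mon_compose:
  assumes "f \<in> module_mon S M N" and "g \<in> module_mon S N P"
  shows "g \<circ> f \<in> module_mon S M P"
proof -
  have f: "f \<in> module_hom S M N" "inj_on f (carrier M)"
    and g: "g \<in> module_hom S N P" "inj_on g (carrier N)"
    using assms by (auto simp: module_mon_def)
  have "g \<circ> f \<in> module_hom S M P"
    by (rule module_homI) (auto simp: module_homD[OF f(1)] module_homD[OF g(1)])
  moreover have "inj_on (g \<circ> f) (carrier M)"
    using f(2) by (rule comp_inj_on)
      (rule inj_on_subset[OF g(2)], auto simp: module_homD[OF f(1)])
  ultimately show ?thesis by (simp add: module_mon_def)
qed

lemma module_iso_imp_mon: "h \<in> module_iso S M N \<Longrightarrow> h \<in> module_mon S M N"
  by (auto simp: module_iso_def module_mon_def bij_betw_def)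

text \<open>\<open>M\<close> is a bare record, so closure of its carrier under addition and scalars
  has to be assumed. Linearity of the inverse then follows by applying \<open>h\<close> to both
  sides and cancelling it on \<open>carrier M\<close>.\<close>

lemma module_iso_inv:
  assumes h: "h \<in> module_iso S M N"
    and add: "\<And>x y. x \<in> carrier M \<Longrightarrow> y \<in> carrier M \<Longrightarrow> x \<oplus>\<^bsub>M\<^esub> y \<in> carrier M"
    and smult: "\<And>a x. a \<in> carrier S \<Longrightarrow> x \<in> carrier M \<Longrightarrow> a \<odot>\<^bsub>M\<^esub> x \<in> carrier M"
  shows "inv_into (carrier M) h \<in> module_iso S N M"
proof -
  let ?g = "inv_into (carrier M) h"
  have hom: "h \<in> module_hom S M N" and bij: "bij_betw h (carrier M) (carrier N)"
    using h by (auto simp: module_iso_def)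
  have hg: "h (?g y) = y" if "y \<in> carrier N" for y
    using bij_betw_inv_into_right[OF bij that] .
  have gh: "?g (h x) = x" if "x \<in> carrier M" for x
    using bij_betw_inv_into_left[OF bij that] .
  have gcl: "?g y \<in> carrier M" if "y \<in> carrier N" for y
    using bij_betw_apply[OF bij_betw_inv_into[OF bij] that] .
  have "?g \<in> module_hom S N M"
  proof (rule module_homI)
    fix x y assume xy: "x \<in> carrier N" "y \<in> carrier N"
    have "h (?g x \<oplus>\<^bsub>M\<^esub> ?g y) = x \<oplus>\<^bsub>N\<^esub> y"
      using xy by (simp add: module_homD[OF hom] gcl hg)
    then show "?g (x \<oplus>\<^bsub>N\<^esub> y) = ?g x \<oplus>\<^bsub>M\<^esub> ?g y"
      using gh[OF add[OF gcl[OF xy(1)] gcl[OF xy(2)]]] by simp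
  next
    fix a y assume ay: "a \<in> carrier S" "y \<in> carrier N"
    have "h (a \<odot>\<^bsub>M\<^esub> ?g y) = a \<odot>\<^bsub>N\<^esub> y"
      using ay by (simp add: module_homD[OF hom] gcl hg)
    then show "?g (a \<odot>\<^bsub>N\<^esub> y) = a \<odot>\<^bsub>M\<^esub> ?g y"
      using gh[OF smult[OF ay(1) gcl[OF ay(2)]]] by simp
  qed (rule gcl)
  then show ?thesis
    using bij_betw_inv_into[OF bij] by (simp add: module_iso_def)
qed

section \<open>Powers of modules\<close>

text \<open>The side of the action is inherited from \<open>M\<close>. For
  \<open>M = right_mod R V\<close> the operations are literally those of
  \<open>right_power R n\<close>, on the smaller carrier of vectors with entries in
  \<open>V\<close>; a map between powers of \<open>R\<close> can thus be restricted without changing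
  it as a function.\<close>

definition power_module :: "('r, 'a) module \<Rightarrow> nat \<Rightarrow> ('r, nat \<Rightarrow> 'a) module" where
  "power_module M n =
    \<lparr>carrier = {..<n} \<rightarrow>\<^sub>E carrier M, monoid.mult = undefined, one = undefined,
     ring.zero = (\<lambda>i\<in>{..<n}. \<zero>\<^bsub>M\<^esub>),
     ring.add = (\<lambda>x y. \<lambda>i\<in>{..<n}. x i \<oplus>\<^bsub>M\<^esub> y i),
     smult = (\<lambda>a x. \<lambda>i\<in>{..<n}. a \<odot>\<^bsub>M\<^esub> x i)\<rparr>"

lemma power_module_simps [simp]:
  "carrier (power_module M n) = {..<n} \<rightarrow>\<^sub>E carrier M"
  "x \<oplus>\<^bsub>power_module M n\<^esub> y = (\<lambda>i\<in>{..<n}. x i \<oplus>\<^bsub>M\<^esub> y i)"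
  "a \<odot>\<^bsub>power_module M n\<^esub> x = (\<lambda>i\<in>{..<n}. a \<odot>\<^bsub>M\<^esub> x i)"
  by (simp_all add: power_module_def)

lemma right_power_simps [simp]:
  "carrier (right_power S n) = {..<n} \<rightarrow>\<^sub>E carrier S"
  "x \<oplus>\<^bsub>right_power S n\<^esub> y = (\<lambda>i\<in>{..<n}. x i \<oplus>\<^bsub>S\<^esub> y i)"
  "a \<odot>\<^bsub>right_power S n\<^esub> x = (\<lambda>i\<in>{..<n}. x i \<otimes>\<^bsub>S\<^esub> a)"
  by (simp_all add: right_power_def)

lemma left_power_simps [simp]:
  "carrier (left_power S n) = {..<n} \<rightarrow>\<^sub>E carrier S"
  "x \<oplus>\<^bsub>left_power S n\<^esub> y = (\<lambda>i\<in>{..<n}. x i \<oplus>\<^bsub>S\<^esub> y i)"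
  "a \<odot>\<^bsub>left_power S n\<^esub> x = (\<lambda>i\<in>{..<n}. a \<otimes>\<^bsub>S\<^esub> x i)"
  by (simp_all add: left_power_def)

lemma right_mod_simps [simp]:
  "carrier (right_mod R V) = V"
  "x \<oplus>\<^bsub>right_mod R V\<^esub> y = x \<oplus>\<^bsub>R\<^esub> y"
  "a \<odot>\<^bsub>right_mod R V\<^esub> x = x \<otimes>\<^bsub>R\<^esub> a"
  by (simp_all add: right_mod_def)

lemma left_mod_simps [simp]:
  "carrier (left_mod R V) = V"
  "x \<oplus>\<^bsub>left_mod R V\<^esub> y = x \<oplus>\<^bsub>R\<^esub> y"
  "a \<odot>\<^bsub>left_mod R V\<^esub> x = a \<otimes>\<^bsub>R\<^esub> x"
  by (simp_all add: left_mod_def)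

text \<open>Bounds the index that flattens \<open>n\<close> consecutive blocks of length
  \<open>k\<close> into one vector of length \<open>n * k\<close>.\<close>

lemma block_index_less:
  fixes j l k n :: nat
  assumes "j < n" "l < k"
  shows "j * k + l < n * k"
proof -
  have "j * k + l < Suc j * k" using assms by simp
  also have "\<dots> \<le> n * k" using assms by (intro mult_le_mono1) simp
  finally show ?thesis .
qed

text \<open>A vector of length \<open>n * k\<close> is cut into \<open>n\<close> blocks of length
  \<open>k\<close>, and the given isomorphism \<open>h\<close> is applied to each block. Division
  with remainder by \<open>k\<close> recovers block and position, which yields bijectivity.\<close>

lemma right_free_of_rank_power_module:
  assumes "right_free_of_rank S M k"
  shows "right_free_of_rank S (power_module M n) (n * k)"
proof -
  obtain h where h: "h \<in> module_iso S (right_power S k) M"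
    using assms by (auto simp: right_free_of_rank_def)
  then have hom: "h \<in> module_hom S (right_power S k) M"
    and bij: "bij_betw h ({..<k} \<rightarrow>\<^sub>E carrier S) (carrier M)"
    by (auto simp: module_iso_def)
  define sl where "sl x j = (\<lambda>l\<in>{..<k}. x (j * k + l))" for x :: "nat \<Rightarrow> 'a" and j
  define H where "H x = (\<lambda>j\<in>{..<n}. h (sl x j))" for x
  have slcl: "sl x j \<in> {..<k} \<rightarrow>\<^sub>E carrier S" if "x \<in> {..<n*k} \<rightarrow>\<^sub>E carrier S" "j < n" for x j
    using that block_index_less by (auto simp: sl_def)
  have Hhom: "H \<in> module_hom S (right_power S (n * k)) (power_module M n)"
  proof (rule module_homI)
    fix x assume "x \<in> carrier (right_power S (n * k))"
    then show "H x \<in> carrier (power_module M n)"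
      using slcl module_homD(1)[OF hom] by (auto simp: H_def)
  next
    fix x y
    assume "x \<in> carrier (right_power S (n * k))" "y \<in> carrier (right_power S (n * k))"
    moreover have "sl (x \<oplus>\<^bsub>right_power S (n * k)\<^esub> y) j = sl x j \<oplus>\<^bsub>right_power S k\<^esub> sl y j"
      if "j < n" for j
      using that block_index_less by (auto simp: sl_def)
    ultimately show "H (x \<oplus>\<^bsub>right_power S (n * k)\<^esub> y) = H x \<oplus>\<^bsub>power_module M n\<^esub> H y"
      using module_homD(2)[OF hom] slcl
      by (auto simp: H_def simp del: right_power_simps(2) intro!: restrict_ext)
  next
    fix a x
    assume "a \<in> carrier S" "x \<in> carrier (right_power S (n * k))"
    moreover have "sl (a \<odot>\<^bsub>right_power S (n * k)\<^esub> x) j = a \<odot>\<^bsub>right_power S k\<^esub> sl x j"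
      if "j < n" for j
      using that block_index_less by (auto simp: sl_def)
    ultimately show "H (a \<odot>\<^bsub>right_power S (n * k)\<^esub> x) = a \<odot>\<^bsub>power_module M n\<^esub> H x"
      using module_homD(3)[OF hom] slcl
      by (auto simp: H_def simp del: right_power_simps(3) intro!: restrict_ext)
  qed
  \<comment> \<open>The existence of some \<open>m < n * k\<close> already forces \<open>k\<close>
    to be positive, so rank zero is covered.\<close>
  have div_less: "m div k < n" and mod_less: "m mod k < k" if "m < n * k" for m
    using that by (auto simp: less_mult_imp_div_less intro!: mod_less_divisor gr0I)
  have "inj_on H ({..<n*k} \<rightarrow>\<^sub>E carrier S)"
  proof (rule inj_onI)
    fix x y assume x: "x \<in> {..<n*k} \<rightarrow>\<^sub>E carrier S" and y: "y \<in> {..<n*k} \<rightarrow>\<^sub>E carrier S"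
      and eq: "H x = H y"
    show "x = y"
    proof (rule PiE_ext[OF x y])
      fix m assume "m \<in> {..<n*k}"
      then have m: "m div k < n" "m mod k < k" using div_less mod_less by auto
      have "h (sl x (m div k)) = h (sl y (m div k))"
        using fun_cong[OF eq, of "m div k"] m by (simp add: H_def)
      then have "sl x (m div k) = sl y (m div k)"
        using bij slcl[OF x m(1)] slcl[OF y m(1)] by (auto simp: bij_betw_def inj_on_def)
      from fun_cong[OF this, of "m mod k"] show "x m = y m"
        using m by (simp add: sl_def)
    qed
  qed
  moreover have "\<exists>x\<in>{..<n*k} \<rightarrow>\<^sub>E carrier S. H x = y" if y: "y \<in> {..<n} \<rightarrow>\<^sub>E carrier M" for y
  proof -
    let ?g = "inv_into ({..<k} \<rightarrow>\<^sub>E carrier S) h"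
    \<comment> \<open>Concatenates the \<open>h\<close>-preimages of the entries of
      \<open>y\<close>: entry \<open>m\<close> lies in block \<open>m div k\<close> at position
      \<open>m mod k\<close>.\<close>
    define x where "x = (\<lambda>m\<in>{..<n*k}. ?g (y (m div k)) (m mod k))"
    have g: "?g (y j) \<in> {..<k} \<rightarrow>\<^sub>E carrier S" "h (?g (y j)) = y j" if "j < n" for j
      using that y bij_betw_apply[OF bij_betw_inv_into[OF bij], of "y j"]
        bij_betw_inv_into_right[OF bij, of "y j"] by auto
    have xcl: "x \<in> {..<n*k} \<rightarrow>\<^sub>E carrier S"
      unfolding x_def
    proof (rule restrict_PiE_iff[THEN iffD2], rule ballI)
      fix m assume "m \<in> {..<n*k}"
      then show "?g (y (m div k)) (m mod k) \<in> carrier S"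
        using PiE_mem[OF g(1)[OF div_less], of m "m mod k"] mod_less[of m] by simp
    qed
    have slx: "sl x j = ?g (y j)" if j: "j < n" for j
    proof (rule PiE_ext[OF slcl[OF xcl j] g(1)[OF j]])
      fix l assume "l \<in> {..<k}"
      then show "sl x j l = ?g (y j) l"
        using block_index_less[OF j, of l k] by (simp add: sl_def x_def)
    qed
    have "H x = y"
    proof (rule PiE_ext[OF _ y])
      show "H x \<in> {..<n} \<rightarrow>\<^sub>E carrier M" using module_homD(1)[OF Hhom] xcl by simp
    qed (simp add: H_def slx g(2))
    with xcl show ?thesis by blast
  qed
  moreover have "H ` ({..<n*k} \<rightarrow>\<^sub>E carrier S) \<subseteq> {..<n} \<rightarrow>\<^sub>E carrier M"
    using module_homD(1)[OF Hhom] by (simp add: image_subset_iff)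
  ultimately have "bij_betw H ({..<n*k} \<rightarrow>\<^sub>E carrier S) ({..<n} \<rightarrow>\<^sub>E carrier M)"
    unfolding bij_betw_def by blast
  with Hhom have "H \<in> module_iso S (right_power S (n * k)) (power_module M n)"
    by (simp add: module_iso_def)
  then show ?thesis by (auto simp: right_free_of_rank_def)
qed

text \<open>Padding with zeros. This reduces a monomorphism out of a larger power to one out of
  exactly one more copy than the target, the only case that \<open>RSRC\<close> mentions.\<close>

lemma (in ring) right_power_extend:
  assumes "m \<le> m'"
  shows "(\<lambda>x. \<lambda>i\<in>{..<m'}. if i < m then x i else \<zero>)
    \<in> module_mon R (right_power R m) (right_power R m')" (is "?e \<in> _")
proof -
  have "?e \<in> module_hom R (right_power R m) (right_power R m')"
  proof (rule module_homI)
    fix x assume "x \<in> carrier (right_power R m)"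
    then show "?e x \<in> carrier (right_power R m')"
      by (auto simp: PiE_mem Pi_iff)
  next
    fix x y :: "nat \<Rightarrow> 'a"
    show "?e (x \<oplus>\<^bsub>right_power R m\<^esub> y) = ?e x \<oplus>\<^bsub>right_power R m'\<^esub> ?e y"
      unfolding right_power_simps using assms by (intro restrict_ext) simp
  next
    fix a and x :: "nat \<Rightarrow> 'a" assume "a \<in> carrier R"
    then show "?e (a \<odot>\<^bsub>right_power R m\<^esub> x) = a \<odot>\<^bsub>right_power R m'\<^esub> ?e x"
      unfolding right_power_simps using assms by (intro restrict_ext) simp
  qed
  moreover have "inj_on ?e ({..<m} \<rightarrow>\<^sub>E carrier R)"
  proof (rule inj_onI)
    fix x y assume xy: "x \<in> {..<m} \<rightarrow>\<^sub>E carrier R" "y \<in> {..<m} \<rightarrow>\<^sub>E carrier R"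
      and eq: "?e x = ?e y"
    show "x = y"
    proof (rule PiE_ext[OF xy])
      fix i assume "i \<in> {..<m}"
      then show "x i = y i" using fun_cong[OF eq, of i] assms by simp
    qed
  qed
  ultimately show ?thesis by (simp add: module_mon_def)
qed

lemma (in ring) RSRC_free_mon_empty:
  assumes "RSRC R" and "right_free_of_rank R M m" and "right_free_of_rank R N k"
    and "0 < k" and "k < m"
  shows "module_mon R M N = {}"
proof (rule ccontr)
  assume "module_mon R M N \<noteq> {}"
  then obtain f where f: "f \<in> module_mon R M N" by blast
  obtain g where g: "g \<in> module_iso R (right_power R m) M"
    using assms(2) by (auto simp: right_free_of_rank_def)
  obtain h where h: "h \<in> module_iso R (right_power R k) N"
    using assms(3) by (auto simp: right_free_of_rank_def)
  have "inv_into (carrier (right_power R k)) h \<in> module_iso R N (right_power R k)"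
    by (rule module_iso_inv[OF h]) auto
  then have h': "inv_into (carrier (right_power R k)) h \<in> module_mon R N (right_power R k)"
    by (rule module_iso_imp_mon)
  have "k + 1 \<le> m" using assms(5) by simp
  note e = right_power_extend[OF this]
  show False
    using module_mon_compose[OF module_mon_compose[OF module_mon_compose[OF e
          module_iso_imp_mon[OF g]] f] h'] assms(1,4)
    by (auto simp: RSRC_def)
qed

section \<open>Matrices of homomorphisms\<close>

text \<open>Only zero and one of \<open>R\<close> enter, and changing the carrier keeps them. The
  same vectors therefore serve every subring.\<close>

definition unit_vec :: "('a, 'm) ring_scheme \<Rightarrow> nat \<Rightarrow> nat \<Rightarrow> nat \<Rightarrow> 'a" where
  "unit_vec R m j = (\<lambda>i\<in>{..<m}. if i = j then \<one>\<^bsub>R\<^esub> else \<zero>\<^bsub>R\<^esub>)"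

text \<open>Writing \<open>x\<close> as the sum of the unit vectors times its entries on the right
  shows that \<open>h\<close> is left multiplication by the matrix with columns
  \<open>h (unit_vec R m j)\<close>. The subring \<open>V\<close> allows two uses: all of
  \<open>R\<close>, and \<open>U 0\<close> with sums still formed in \<open>R\<close>.\<close>

lemma (in ring) right_power_hom_matrix:
  assumes V: "subring V R"
    and h: "h \<in> module_hom (R\<lparr>carrier := V\<rparr>) (right_power (R\<lparr>carrier := V\<rparr>) m)
                  (right_power (R\<lparr>carrier := V\<rparr>) n)"
    and x: "x \<in> {..<m} \<rightarrow>\<^sub>E V" and k: "k < n"
  shows "h x k = (\<Oplus>j\<in>{..<m}. h (unit_vec R m j) k \<otimes> x j)"
proof -
  have V_sub: "V \<subseteq> carrier R" and V0: "\<zero> \<in> V" and V1: "\<one> \<in> V"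
    using subringE[OF V] by auto
  have u: "unit_vec R m j \<in> {..<m} \<rightarrow>\<^sub>E V" for j
    using V0 V1 by (auto simp: unit_vec_def)
  have cl: "h y k \<in> carrier R" if "y \<in> {..<m} \<rightarrow>\<^sub>E V" for y
    using PiE_mem[of "h y" _ _ k] module_homD(1)[OF h, of y] that k V_sub by auto
  have ucl: "h (unit_vec R m j) k \<otimes> x j \<in> carrier R" if "j < m" for j
    using cl[OF u] PiE_mem[OF x] that V_sub by (simp add: subset_iff)
  \<comment> \<open>Truncation to the first \<open>p\<close> coordinates. Induction on
    \<open>p\<close> adds one column at a time, so only binary sums in the power are needed.\<close>
  define tr where "tr p = (\<lambda>i\<in>{..<m}. if i < p then x i else \<zero>)" for p
  have trcl: "tr p \<in> {..<m} \<rightarrow>\<^sub>E V" for p using PiE_mem[OF x] V0 by (simp add: tr_def)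
  have "h (tr p) k = (\<Oplus>j\<in>{..<p}. h (unit_vec R m j) k \<otimes> x j)" if "p \<le> m" for p
    using that
  proof (induction p)
    case 0
    \<comment> \<open>That zero goes to zero is not part of \<open>module_hom\<close>; it comes from
      linearity for the scalar zero.\<close>
    have "tr 0 = \<zero> \<odot>\<^bsub>right_power (R\<lparr>carrier := V\<rparr>) m\<^esub> tr 0"
      by (auto simp: tr_def)
    then have "h (tr 0) = \<zero> \<odot>\<^bsub>right_power (R\<lparr>carrier := V\<rparr>) n\<^esub> h (tr 0)"
      using module_homD(3)[OF h, of \<zero> "tr 0"] trcl V0 by simp
    from fun_cong[OF this, of k] show ?case using k cl[OF trcl] by simp
  next
    case (Suc p)
    then have p: "p < m" by simp
    have xp: "x p \<in> V" using PiE_mem[OF x] p by simp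
    let ?y = "x p \<odot>\<^bsub>right_power (R\<lparr>carrier := V\<rparr>) m\<^esub> unit_vec R m p"
    have ycl: "?y \<in> {..<m} \<rightarrow>\<^sub>E V"
      using PiE_mem[OF u] xp subringE(6)[OF V] by simp
    have "tr (Suc p) = tr p \<oplus>\<^bsub>right_power (R\<lparr>carrier := V\<rparr>) m\<^esub> ?y"
      using PiE_mem[OF x] V_sub xp by (auto simp: tr_def unit_vec_def less_Suc_eq subset_iff intro!: restrict_ext)
    then have "h (tr (Suc p)) = h (tr p) \<oplus>\<^bsub>right_power (R\<lparr>carrier := V\<rparr>) n\<^esub> h ?y"
      using module_homD(2)[OF h, of "tr p" ?y] trcl ycl by simp
    also have "h ?y = x p \<odot>\<^bsub>right_power (R\<lparr>carrier := V\<rparr>) n\<^esub> h (unit_vec R m p)"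
      using module_homD(3)[OF h, of "x p" "unit_vec R m p"] u xp by simp
    finally have "h (tr (Suc p)) k = h (tr p) k \<oplus> h (unit_vec R m p) k \<otimes> x p"
      using k by simp
    then show ?case
      using Suc ucl p cl[OF trcl]
      by (simp add: lessThan_Suc a_comm Pi_iff finsum_closed)
  qed
  moreover have "tr m = x" by (rule PiE_ext[OF trcl x]) (simp add: tr_def)
  ultimately show ?thesis by force
qed

section \<open>Strong rank conditions and filtrations\<close>

context ring_filtration
begin

section \<open>Finite sets and finite sums inside the filtration\<close>

lemma filt_mono_le: "i \<le> j \<Longrightarrow> U i \<subseteq> U j"
  using lift_Suc_mono_le[of U i j] filt_mono by blast

text \<open>Each element lies in some \<open>U e\<close>, and in a chain the largest of finitely
  many indices works for all. This bounds the entries of a matrix, or of two vectors, by one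
  index.\<close>

lemma finite_subset_filt:
  assumes "finite A" "A \<subseteq> carrier R"
  shows "\<exists>d. A \<subseteq> U d"
  using assms
proof (induction A rule: finite_induct)
  case (insert a A)
  then obtain d where "A \<subseteq> U d" by auto
  moreover obtain e where "a \<in> U e" using insert.prems filt_exhaustive by auto
  ultimately have "insert a A \<subseteq> U (max d e)"
    using filt_mono_le[of d "max d e"] filt_mono_le[of e "max d e"] by auto
  then show ?case by blast
qed simp

lemma filt_zero: "\<zero> \<in> U i"
  using filt_additive_subgroup by (rule additive_subgroup.zero_closed)

lemma filt_add: "a \<in> U i \<Longrightarrow> b \<in> U i \<Longrightarrow> a \<oplus> b \<in> U i"
  using filt_additive_subgroup by (rule additive_subgroup.a_closed)

lemma filt_finsum:
  assumes "finite A" "\<And>j. j \<in> A \<Longrightarrow> f j \<in> U i"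
  shows "finsum R f A \<in> U i"
  using assms
proof (induction A rule: finite_induct)
  case (insert a A)
  then have "f \<in> A \<rightarrow> carrier R" "f a \<in> carrier R" using filt_subset by auto
  then show ?case using insert by (simp add: filt_add)
qed (simp add: filt_zero)

section \<open>Ascent of the strong rank condition from \<open>U 0\<close> to
  \<open>R\<close>\<close>

lemma RSRC_filtered:
  assumes free: "\<And>i. right_free_of_rank (R\<lparr>carrier := U 0\<rparr>) (right_mod R (U i)) (i + 1)"
    and rsrc: "RSRC (R\<lparr>carrier := U 0\<rparr>)"
  shows "RSRC R"
  unfolding RSRC_def
proof (intro allI impI equals0I)
  fix n :: nat and f
  assume n: "0 < n" and f: "f \<in> module_mon R (right_power R (n + 1)) (right_power R n)"
  let ?S = "R\<lparr>carrier := U 0\<rparr>"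
  have hom: "f \<in> module_hom R (right_power R (n + 1)) (right_power R n)"
    and inj: "inj_on f ({..<n+1} \<rightarrow>\<^sub>E carrier R)"
    using f by (auto simp: module_mon_def)
  \<comment> \<open>The finite set of matrix entries of \<open>f\<close>.\<close>
  define A where "A = (\<lambda>(j, k). f (unit_vec R (n + 1) j) k) ` ({..<n+1} \<times> {..<n})"
  have "A \<subseteq> carrier R"
    using module_homD(1)[OF hom, of "unit_vec R (n + 1) _"]
    by (fastforce simp: A_def unit_vec_def PiE_iff)
  then obtain d where d: "A \<subseteq> U d"
    using finite_subset_filt[of A] by (auto simp: A_def)
  \<comment> \<open>The ranks $(n+1)(i+1)$ and $n(i+d+1)$ differ by $i+1-nd$, so this is the least
    \<open>i\<close> for which the source has the larger rank, by exactly one.\<close>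
  define i where "i = n * d"
  have sub: "({..<m} \<rightarrow>\<^sub>E U p) \<subseteq> ({..<m} \<rightarrow>\<^sub>E carrier R)" for m p
    using filt_subset by (intro PiE_mono)
  have fU: "f x \<in> {..<n} \<rightarrow>\<^sub>E U (i + d)" if x: "x \<in> {..<n+1} \<rightarrow>\<^sub>E U i" for x
  proof (rule PiE_I)
    fix k assume "k \<in> {..<n}"
    then have k: "k < n" by simp
    have "f x k = (\<Oplus>j\<in>{..<n+1}. f (unit_vec R (n + 1) j) k \<otimes> x j)"
      using right_power_hom_matrix[OF carrier_is_subring, of f "n + 1" n x k] hom k subsetD[OF sub x]
      by simp
    moreover have "f (unit_vec R (n + 1) j) k \<otimes> x j \<in> U (i + d)" if j: "j \<in> {..<n+1}" for j
    proof -
      have "f (unit_vec R (n + 1) j) k \<in> U d"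
        using d j k by (force simp: A_def)
      then show ?thesis
        using filt_multI[of _ d "x j" i] x j by (auto simp: PiE_iff add.commute)
    qed
    ultimately show "f x k \<in> U (i + d)"
      using filt_finsum[of "{..<n+1}" "\<lambda>j. f (unit_vec R (n + 1) j) k \<otimes> x j"] by simp
  \<comment> \<open>Membership in the extensional function space also asks for the value
    \<open>undefined\<close> off the index set; this is inherited from the codomain of
    \<open>f\<close>.\<close>
  next
    fix k assume "k \<notin> {..<n}"
    then show "f x k = undefined"
      using PiE_arb[of "f x" "{..<n}"] module_homD(1)[OF hom, of x] subsetD[OF sub x] by simp
  qed
  let ?M = "power_module (right_mod R (U i)) (n + 1)"
  let ?N = "power_module (right_mod R (U (i + d))) n"
  \<comment> \<open>Restriction of scalars to \<open>U 0\<close>: the function is still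
    \<open>f\<close>, and its linearity over \<open>R\<close> specialises.\<close>
  have "f \<in> module_hom ?S ?M ?N"
  proof (rule module_homI)
    fix x assume "x \<in> carrier ?M"
    then show "f x \<in> carrier ?N" using fU by simp
  next
    fix x y assume "x \<in> carrier ?M" "y \<in> carrier ?M"
    then have "x \<in> carrier (right_power R (n + 1))" "y \<in> carrier (right_power R (n + 1))"
      using subsetD[OF sub] by simp_all
    from module_homD(2)[OF hom this]
    show "f (x \<oplus>\<^bsub>?M\<^esub> y) = f x \<oplus>\<^bsub>?N\<^esub> f y" by simp
  next
    fix a x assume "a \<in> carrier ?S" "x \<in> carrier ?M"
    then have "a \<in> carrier R" "x \<in> carrier (right_power R (n + 1))"
      using subsetD[OF sub] subsetD[OF filt_subset] by simp_all
    from module_homD(3)[OF hom this]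
    show "f (a \<odot>\<^bsub>?M\<^esub> x) = a \<odot>\<^bsub>?N\<^esub> f x" by simp
  qed
  moreover have "inj_on f (carrier ?M)"
    using inj_on_subset[OF inj sub] by simp
  ultimately have "f \<in> module_mon ?S ?M ?N"
    by (simp add: module_mon_def)
  moreover have "module_mon ?S ?M ?N = {}"
  proof (rule ring.RSRC_free_mon_empty[OF filt_ring_zero rsrc])
    show "right_free_of_rank ?S ?M ((n + 1) * (i + 1))"
      by (rule right_free_of_rank_power_module[OF free])
    show "right_free_of_rank ?S ?N (n * (i + d + 1))"
      by (rule right_free_of_rank_power_module[OF free])
    show "0 < n * (i + d + 1)" using n by simp
    show "n * (i + d + 1) < (n + 1) * (i + 1)"
      by (simp add: i_def algebra_simps)
  qed
  ultimately show False by blast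
qed

section \<open>Descent of the strong rank condition from \<open>R\<close> to
  \<open>U 0\<close>\<close>

lemma left_free_hom_finsum:
  fixes m :: nat
  assumes e: "e \<in> module_hom (R\<lparr>carrier := U 0\<rparr>) (left_power (R\<lparr>carrier := U 0\<rparr>) r)
                  (left_mod R (U i))"
    and a: "\<And>j. j < m \<Longrightarrow> a j \<in> U 0" and c: "\<And>j. j < m \<Longrightarrow> c j \<in> {..<r} \<rightarrow>\<^sub>E U 0"
  shows "e (\<lambda>l\<in>{..<r}. \<Oplus>j\<in>{..<m}. a j \<otimes> c j l) = (\<Oplus>j\<in>{..<m}. a j \<otimes> e (c j))"
  using a c
\<comment> \<open>Finite sums are formed coordinatewise in \<open>R\<close>, never in the power
  itself, so additivity of \<open>e\<close> is applied one term at a time; the empty sum uses the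
  scalar zero.\<close>
proof (induction m)
  case 0
  let ?z = "\<lambda>l\<in>{..<r}. \<zero>"
  have z: "?z \<in> {..<r} \<rightarrow>\<^sub>E U 0" using filt_zero by simp
  have "\<zero> \<odot>\<^bsub>left_power (R\<lparr>carrier := U 0\<rparr>) r\<^esub> ?z = ?z"
    by auto
  then have "e ?z = \<zero> \<otimes> e ?z"
    using module_homD(3)[OF e, of \<zero> ?z] z filt_zero by simp
  moreover have "e ?z \<in> carrier R"
    using module_homD(1)[OF e, of ?z] z filt_subset by auto
  ultimately have "e ?z = \<zero>" by simp
  then show ?case by (simp only: lessThan_0 finsum_empty)
next
  case (Suc m)
  let ?S = "R\<lparr>carrier := U 0\<rparr>"
  let ?s = "\<lambda>l\<in>{..<r}. \<Oplus>j\<in>{..<m}. a j \<otimes> c j l"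
  let ?t = "a m \<odot>\<^bsub>left_power ?S r\<^esub> c m"
  have prod: "a j \<otimes> c j l \<in> U 0" if "j < Suc m" "l < r" for j l
    using filt_multI[of "a j" 0 "c j l" 0] Suc.prems that by (auto simp: PiE_iff)
  then have prodR: "a j \<otimes> c j l \<in> carrier R" if "j < Suc m" "l < r" for j l
    using that filt_subset by blast
  have ecl: "a j \<otimes> e (c j) \<in> carrier R" if "j < Suc m" for j
    using Suc.prems that module_homD(1)[OF e, of "c j"] filt_subset[of 0] filt_subset[of i]
    by (auto simp: subset_iff)
  have s: "?s \<in> {..<r} \<rightarrow>\<^sub>E U 0" and t: "?t \<in> {..<r} \<rightarrow>\<^sub>E U 0"
    using prod by (auto intro!: filt_finsum)
  have "(\<lambda>l\<in>{..<r}. \<Oplus>j\<in>{..<Suc m}. a j \<otimes> c j l) = ?s \<oplus>\<^bsub>left_power ?S r\<^esub> ?t"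
    using prodR by (auto simp: fun_eq_iff lessThan_Suc Pi_iff a_comm finsum_closed)
  then have "e (\<lambda>l\<in>{..<r}. \<Oplus>j\<in>{..<Suc m}. a j \<otimes> c j l) = e ?s \<oplus> e ?t"
    using module_homD(2)[OF e, of ?s ?t] s t by simp
  also have "e ?t = a m \<otimes> e (c m)"
    using module_homD(3)[OF e, of "a m" "c m"] Suc.prems by simp
  also have "e ?s = (\<Oplus>j\<in>{..<m}. a j \<otimes> e (c j))"
    using Suc.prems by (intro Suc.IH) simp_all
  finally show ?case
    using ecl by (simp add: lessThan_Suc Pi_iff a_comm finsum_closed)
qed

text \<open>A right linear map multiplies columns by matrix entries from the left, and coordinates
  of a free left \<open>U 0\<close>-module are compatible with exactly this multiplication. Hence
  left freeness is what transfers the right condition.\<close>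

lemma RSRC_filt_zero:
  assumes free: "\<And>i. left_free_of_rank (R\<lparr>carrier := U 0\<rparr>) (left_mod R (U i)) (i + 1)"
    and rsrc: "RSRC R"
  shows "RSRC (R\<lparr>carrier := U 0\<rparr>)"
  unfolding RSRC_def
proof (intro allI impI equals0I)
  let ?S = "R\<lparr>carrier := U 0\<rparr>"
  fix n :: nat and f
  assume n: "0 < n" and f: "f \<in> module_mon ?S (right_power ?S (n + 1)) (right_power ?S n)"
  have hom: "f \<in> module_hom ?S (right_power ?S (n + 1)) (right_power ?S n)"
    and inj: "inj_on f ({..<n+1} \<rightarrow>\<^sub>E U 0)"
    using f by (auto simp: module_mon_def)
  define a where "a k j = f (unit_vec R (n + 1) j) k" for k j
  have a: "a k j \<in> U 0" if "k < n" for k j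
    using module_homD(1)[OF hom, of "unit_vec R (n + 1) j"] that filt_zero filt_one
    by (auto simp: a_def unit_vec_def PiE_iff)
  have aR: "a k j \<in> carrier R" if "k < n" for k j
    using a[OF that] filt_subset by blast
  \<comment> \<open>The matrix of \<open>f\<close>, now acting on columns over
    \<open>R\<close>.\<close>
  define g where "g x = (\<lambda>k\<in>{..<n}. \<Oplus>j\<in>{..<n+1}. a k j \<otimes> x j)" for x
  have "g \<in> module_hom R (right_power R (n + 1)) (right_power R n)"
  proof (rule module_homI)
    fix x assume "x \<in> carrier (right_power R (n + 1))"
    then show "g x \<in> carrier (right_power R n)"
      using aR by (auto simp: g_def PiE_iff intro!: finsum_closed)
  next
    fix x y
    assume xy: "x \<in> carrier (right_power R (n + 1))" "y \<in> carrier (right_power R (n + 1))"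
    have "(\<Oplus>j\<in>{..<n+1}. a k j \<otimes> (x \<oplus>\<^bsub>right_power R (n + 1)\<^esub> y) j) =
        (\<Oplus>j\<in>{..<n+1}. a k j \<otimes> x j \<oplus> a k j \<otimes> y j)" if "k < n" for k
      using xy aR[OF that] by (intro finsum_cong') (auto simp: r_distr PiE_iff)
    moreover have "\<dots> k = (\<Oplus>j\<in>{..<n+1}. a k j \<otimes> x j) \<oplus> (\<Oplus>j\<in>{..<n+1}. a k j \<otimes> y j)"
      if "k < n" for k
      using xy aR[OF that] by (intro finsum_addf) (auto simp: PiE_iff)
    ultimately show "g (x \<oplus>\<^bsub>right_power R (n + 1)\<^esub> y) = g x \<oplus>\<^bsub>right_power R n\<^esub> g y"
      by (auto simp: g_def)
  next
    fix b x assume b: "b \<in> carrier R" and x: "x \<in> carrier (right_power R (n + 1))"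
    have "(\<Oplus>j\<in>{..<n+1}. a k j \<otimes> (b \<odot>\<^bsub>right_power R (n + 1)\<^esub> x) j) =
        (\<Oplus>j\<in>{..<n+1}. a k j \<otimes> x j) \<otimes> b" if "k < n" for k
    proof -
      have "(\<Oplus>j\<in>{..<n+1}. a k j \<otimes> (b \<odot>\<^bsub>right_power R (n + 1)\<^esub> x) j) =
          (\<Oplus>j\<in>{..<n+1}. a k j \<otimes> x j \<otimes> b)"
        using x b aR[OF that] by (intro finsum_cong') (auto simp: m_assoc PiE_iff)
      also have "\<dots> = (\<Oplus>j\<in>{..<n+1}. a k j \<otimes> x j) \<otimes> b"
        using x b aR[OF that] by (intro finsum_ldistr[symmetric]) (auto simp: PiE_iff)
      finally show ?thesis .
    qed
    then show "g (b \<odot>\<^bsub>right_power R (n + 1)\<^esub> x) = b \<odot>\<^bsub>right_power R n\<^esub> g x"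
      by (auto simp: g_def)
  qed
  moreover have "inj_on g ({..<n+1} \<rightarrow>\<^sub>E carrier R)"
  proof (rule inj_onI)
    fix x y assume x: "x \<in> {..<n+1} \<rightarrow>\<^sub>E carrier R" and y: "y \<in> {..<n+1} \<rightarrow>\<^sub>E carrier R"
      and eq: "g x = g y"
    have "x ` {..<n+1} \<union> y ` {..<n+1} \<subseteq> carrier R" using x y by (auto simp: PiE_iff)
    then obtain i where i: "x ` {..<n+1} \<union> y ` {..<n+1} \<subseteq> U i"
      using finite_subset_filt[of "x ` {..<n+1} \<union> y ` {..<n+1}"] by auto
    obtain e where e: "e \<in> module_iso ?S (left_power ?S (i + 1)) (left_mod R (U i))"
      using free[of i] by (auto simp: left_free_of_rank_def)
    then have ehom: "e \<in> module_hom ?S (left_power ?S (i + 1)) (left_mod R (U i))"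
      and ebij: "bij_betw e ({..<i+1} \<rightarrow>\<^sub>E U 0) (U i)"
      by (auto simp: module_iso_def)
    define coord where "coord = inv_into ({..<i+1} \<rightarrow>\<^sub>E U 0) e"
    have coord: "coord u \<in> {..<i+1} \<rightarrow>\<^sub>E U 0" "e (coord u) = u" if "u \<in> U i" for u
      using bij_betw_apply[OF bij_betw_inv_into[OF ebij] that]
        bij_betw_inv_into_right[OF ebij that] by (auto simp: coord_def)
    \<comment> \<open>The coordinates \<open>coord (z j) l\<close> form a matrix over
      \<open>U 0\<close> with \<open>n + 1\<close> rows and \<open>i + 1\<close> columns.
      \<open>row z k\<close> is row \<open>k\<close> of its product with the matrix of
      \<open>f\<close> and gives the coordinates of \<open>g z k\<close>; \<open>col z l\<close> is
      its column \<open>l\<close>, which \<open>f\<close> sends to column \<open>l\<close> of the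
      product.\<close>
    define row where
      "row z k = (\<lambda>l\<in>{..<i+1}. \<Oplus>j\<in>{..<n+1}. a k j \<otimes> coord (z j) l)" for z k
    define col where "col z l = (\<lambda>j\<in>{..<n+1}. coord (z j) l)" for z l
    have zrow: "row z k \<in> {..<i+1} \<rightarrow>\<^sub>E U 0" "e (row z k) = g z k"
      if "z ` {..<n+1} \<subseteq> U i" "k < n" for z k
    proof -
      have zU: "z j \<in> U i" if "j < n + 1" for j using that \<open>z ` _ \<subseteq> _\<close> by auto
      have "a k j \<otimes> coord (z j) l \<in> U 0" if "j < n + 1" "l < i + 1" for j l
        using filt_multI[OF a[OF \<open>k < n\<close>], of "coord (z j) l" 0 j] coord(1)[OF zU] that
        by (auto simp: PiE_iff)
      then show "row z k \<in> {..<i+1} \<rightarrow>\<^sub>E U 0"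
        by (auto simp: row_def intro!: filt_finsum)
      have "e (row z k) = (\<Oplus>j\<in>{..<n+1}. a k j \<otimes> e (coord (z j)))"
        unfolding row_def
        by (rule left_free_hom_finsum[OF ehom]) (use a \<open>k < n\<close> coord zU in auto)
      also have "\<dots> = (\<Oplus>j\<in>{..<n+1}. a k j \<otimes> z j)"
        using zU coord(2) aR[OF \<open>k < n\<close>] filt_subset[of i]
        by (intro finsum_cong') (auto simp: subset_iff)
      finally show "e (row z k) = g z k" using \<open>k < n\<close> by (simp add: g_def)
    qed
    have zcol: "col z l \<in> {..<n+1} \<rightarrow>\<^sub>E U 0" "\<And>k. k < n \<Longrightarrow> f (col z l) k = row z k l"
      if "z ` {..<n+1} \<subseteq> U i" "l < i + 1" for z l
    proof -
      show col: "col z l \<in> {..<n+1} \<rightarrow>\<^sub>E U 0"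
        unfolding col_def restrict_PiE_iff
      proof
        fix j assume "j \<in> {..<n+1}"
        then show "coord (z j) l \<in> U 0"
          using that PiE_mem[OF coord(1), of "z j" l] by auto
      qed
      fix k assume k: "k < n"
      have "f (col z l) k = (\<Oplus>j\<in>{..<n+1}. a k j \<otimes> col z l j)"
        using right_power_hom_matrix[OF filt_subring_zero hom col k] by (simp add: a_def)
      also have "\<dots> = (\<Oplus>j\<in>{..<n+1}. a k j \<otimes> coord (z j) l)"
        using col aR[OF k] filt_subset[of 0]
        by (intro finsum_cong') (auto simp: col_def PiE_iff)
      finally show "f (col z l) k = row z k l" using that by (simp add: row_def)
    qed
    \<comment> \<open>Equal entries of \<open>g x\<close> and \<open>g y\<close> have equal
      coordinates, since \<open>e\<close> is injective.\<close>
    have rows: "row x k = row y k" if "k < n" for k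
      using ebij zrow[of x k] zrow[of y k] i that eq by (auto simp: bij_betw_def inj_on_def)
    \<comment> \<open>The two products agree row by row, hence column by column, and injectivity of
      \<open>f\<close> over \<open>U 0\<close> cancels the matrix.\<close>
    have cols: "col x l = col y l" if l: "l < i + 1" for l
    proof -
      have "f (col x l) = f (col y l)"
      proof (rule PiE_ext)
        show "f (col x l) \<in> {..<n} \<rightarrow>\<^sub>E U 0" "f (col y l) \<in> {..<n} \<rightarrow>\<^sub>E U 0"
          using module_homD(1)[OF hom] zcol(1) i l by auto
      qed (use zcol(2) i l rows in auto)
      then show ?thesis using inj zcol(1) i l by (auto simp: inj_on_def)
    qed
    show "x = y"
    proof (rule PiE_ext[OF x y])
      fix j assume j: "j \<in> {..<n+1}"
      have xy: "x j \<in> U i" "y j \<in> U i" using i j by auto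
      have "coord (x j) = coord (y j)"
      proof (rule PiE_ext[OF coord(1)[OF xy(1)] coord(1)[OF xy(2)]])
        fix l assume "l \<in> {..<i+1}"
        then show "coord (x j) l = coord (y j) l"
          using fun_cong[OF cols[of l], of j] j by (simp add: col_def)
      qed
      then show "x j = y j" using coord(2) xy by metis
    qed
  qed
  ultimately have "g \<in> module_mon R (right_power R (n + 1)) (right_power R n)"
    by (simp add: module_mon_def)
  then show False using rsrc n by (auto simp: RSRC_def)
qed

end

section \<open>The opposite ring\<close>

definition opposite :: "('a, 'm) ring_scheme \<Rightarrow> ('a, 'm) ring_scheme" where
  "opposite R = R\<lparr>monoid.mult := (\<lambda>x y. y \<otimes>\<^bsub>R\<^esub> x)\<rparr>"

lemma opposite_simps [simp]:
  "carrier (opposite R) = carrier R"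
  "x \<otimes>\<^bsub>opposite R\<^esub> y = y \<otimes>\<^bsub>R\<^esub> x"
  "\<one>\<^bsub>opposite R\<^esub> = \<one>\<^bsub>R\<^esub>"
  "(\<oplus>\<^bsub>opposite R\<^esub>) = (\<oplus>\<^bsub>R\<^esub>)"
  "\<zero>\<^bsub>opposite R\<^esub> = \<zero>\<^bsub>R\<^esub>"
  by (simp_all add: opposite_def)

lemma opposite_carrier_update: "(opposite R)\<lparr>carrier := V\<rparr> = opposite (R\<lparr>carrier := V\<rparr>)"
  by (simp add: opposite_def)

text \<open>The scalar ring enters \<open>module_hom\<close> only through its carrier; the side of
  the action is stored in the modules.\<close>

lemma module_hom_opposite: "module_hom (opposite S) M N = module_hom S M N"
  by (simp add: module_hom_def)

text \<open>Right modules also take the scalar as first argument of \<open>smult\<close>, so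
  swapping the factors gives equal records rather than merely isomorphic modules.\<close>

lemma power_opposite:
  "left_power (opposite S) n = right_power S n"
  "right_power (opposite S) n = left_power S n"
  by (simp_all add: left_power_def right_power_def)

lemma mod_opposite:
  "left_mod (opposite R) V = right_mod R V"
  "right_mod (opposite R) V = left_mod R V"
  by (simp_all add: left_mod_def right_mod_def)

lemma free_of_rank_opposite:
  "left_free_of_rank (opposite S) M k = right_free_of_rank S M k"
  "right_free_of_rank (opposite S) M k = left_free_of_rank S M k"
  by (simp_all add: left_free_of_rank_def right_free_of_rank_def module_iso_def
      module_hom_opposite power_opposite)

lemma strong_rank_opposite:
  "LSRC (opposite S) = RSRC S"
  "RSRC (opposite S) = LSRC S"
  by (simp_all add: LSRC_def RSRC_def module_mon_def module_hom_opposite power_opposite)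

lemma ring_opposite:
  assumes "ring R"
  shows "ring (opposite R)"
proof -
  interpret ring R by fact
  show ?thesis
  proof (rule ringI)
    show "abelian_group (opposite R)"
      using abelian_group_axioms
      by (auto simp: abelian_group_def abelian_group_axioms_def abelian_monoid_def)
    show "Group.monoid (opposite R)"
      by (rule monoidI) (auto simp: m_assoc)
  qed (auto simp: l_distr r_distr)
qed

lemma ring_filtration_opposite:
  assumes "ring_filtration R U"
  shows "ring_filtration (opposite R) U"
proof -
  interpret ring_filtration R U by fact
  show ?thesis
  proof (intro ring_filtration.intro ring_filtration_axioms.intro)
    show "ring (opposite R)" using ring_axioms by (rule ring_opposite)
    show "additive_subgroup (U i) (opposite R)" for i
      using filt_additive_subgroup[of i] by (simp add: additive_subgroup_def)
    \<comment> \<open>The opposite product of elements of \<open>U i\<close> and \<open>U j\<close>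
      lies in \<open>U (j + i)\<close>, and addition of indices commutes.\<close>
    show "U i <#>\<^bsub>opposite R\<^esub> U j \<subseteq> U (i + j)" for i j
      using filt_multI[of _ j _ i] by (auto simp: set_mult_def add.commute)
  qed (simp_all add: filt_mono filt_exhaustive filt_one)
qed

theorem proposition1p9:
  fixes R :: "('a, 'm) ring_scheme" and U :: "nat \<Rightarrow> 'a set"
  assumes "ring_filtration R U"
  shows "((\<forall>i. left_free_of_rank (R\<lparr>carrier := U 0\<rparr>) (left_mod R (U i)) (i + 1)) \<longrightarrow>
            (LSRC (R\<lparr>carrier := U 0\<rparr>) \<longrightarrow> LSRC R) \<and> (RSRC R \<longrightarrow> RSRC (R\<lparr>carrier := U 0\<rparr>))) \<and>
         ((\<forall>i. right_free_of_rank (R\<lparr>carrier := U 0\<rparr>) (right_mod R (U i)) (i + 1)) \<longrightarrow>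
            (RSRC (R\<lparr>carrier := U 0\<rparr>) \<longrightarrow> RSRC R) \<and> (LSRC R \<longrightarrow> LSRC (R\<lparr>carrier := U 0\<rparr>)))"
proof -
  \<comment> \<open>The two implications about \<open>RSRC\<close> hold for \<open>R\<close>
    directly. Applied to the opposite ring with the same \<open>U\<close> and translated back, they
    become the two about \<open>LSRC\<close>.\<close>
  note opp = ring_filtration_opposite[OF assms]
  note opp_simps = opposite_carrier_update mod_opposite free_of_rank_opposite strong_rank_opposite
  show ?thesis
    using ring_filtration.RSRC_filtered[OF assms] ring_filtration.RSRC_filt_zero[OF assms]
      ring_filtration.RSRC_filtered[OF opp, unfolded opp_simps]
      ring_filtration.RSRC_filt_zero[OF opp, unfolded opp_simps]
    by blast
qed

end
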